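(* For $n, m \in \mathbb{N}$, let $kr_6(n,m)$ be the number of partitions $\lambda_1 \le \lambda_2 \le \cdots \le \lambda_m$ of $n$ into $m$ parts with smallest part at least $2$, at most one appearance of the part $2$, and difference at least three at distance three, such that if parts at distance two differ by at most one, then their sum, together with the intermediate part, is $\equiv 2 \pmod{3}$. Then $$\sum_{m,n \geq 0} kr_6(n,m)\, q^n x^m = \sum_{n_1, n_2, n_3 \geq 0} \frac{ q^{ ( 9n_3^2 + 7n_3 )/2 + 2n_2^2 + 3n_2 + n_1^2 + n_1 + 6n_3n_2 + 3n_3n_1 + 2n_2n_1 }\, (-q; q^2)_{n_2}\, x^{3n_3 + 2n_2 + n_1} }{ (q; q)_{n_1} (q^2; q^2)_{n_2} (q^3; q^3)_{n_3} }.$$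
   Context: $\mathbb{N}=\{0,1,2,\dots\}$. A partition of $n$ into $m$ parts is a non-decreasing sequence $\lambda_1 \le \cdots \le \lambda_m$ of positive integers with sum $n$ (the empty partition is the unique partition of $0$, with $m=0$; it satisfies all the conditions vacuously). "Difference at least $k$ at distance $d$" means $\lambda_{j+d}-\lambda_j \ge k$ for all $1 \le j \le m-d$. The condition on parts at distance two says: for each $1\le j \le m-2$, if $\lambda_{j+2}-\lambda_j \le 1$ then $\lambda_j+\lambda_{j+1}+\lambda_{j+2}$ is in the stated residue class modulo $3$. The $q$-Pochhammer symbol is $(a;q)_n = \prod_{j=1}^{n}(1-aq^{j-1})$, with $(a;q)_0=1$. The identity is one of formal power series in $q$ and $x$. *)

theory Defs
  imports "HOL-Analysis.Analysis"
begin

definition partition_into :: "nat \<Rightarrow> nat \<Rightarrow> nat list \<Rightarrow> bool" where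
  "partition_into n m ps \<longleftrightarrow>
     sorted ps \<and> (\<forall>p \<in> set ps. p > 0) \<and> sum_list ps = n \<and> length ps = m"

(* Lists are indexed from 0, so ps ! j is the part with index j + 1. *)

definition diff_at_least_at_distance :: "nat \<Rightarrow> nat \<Rightarrow> nat list \<Rightarrow> bool" where
  "diff_at_least_at_distance k d ps \<longleftrightarrow>
     (\<forall>j. j + d < length ps \<longrightarrow> ps ! (j + d) \<ge> ps ! j + k)"

definition close_triples_cong :: "nat \<Rightarrow> nat list \<Rightarrow> bool" where
  "close_triples_cong r ps \<longleftrightarrow>
     (\<forall>j. j + 2 < length ps \<longrightarrow> ps ! (j + 2) \<le> ps ! j + 1 \<longrightarrow>
        (ps ! j + ps ! (j + 1) + ps ! (j + 2)) mod 3 = r mod 3)"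

definition kr6_partitions :: "nat \<Rightarrow> nat \<Rightarrow> nat list set" where
  "kr6_partitions n m =
     {ps. partition_into n m ps \<and> (\<forall>p \<in> set ps. p \<ge> 2) \<and> count_list ps 2 \<le> 1 \<and>
          diff_at_least_at_distance 3 3 ps \<and> close_triples_cong 2 ps}"

definition kr6 :: "nat \<Rightarrow> nat \<Rightarrow> nat" where
  "kr6 n m = card (kr6_partitions n m)"

lemma finite_kr6_partitions: "finite (kr6_partitions n m)"
proof (rule finite_subset)
  show "kr6_partitions n m \<subseteq> {ps. set ps \<subseteq> {..n} \<and> length ps = m}"
    by (auto simp: kr6_partitions_def partition_into_def dest: member_le_sum_list)
  show "finite {ps. set ps \<subseteq> {..n} \<and> length ps = m}"
    by (rule finite_lists_length_eq) simp
qed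

definition qpochhammer :: "'a::comm_ring_1 \<Rightarrow> 'a \<Rightarrow> nat \<Rightarrow> 'a" where
  "qpochhammer a q n = (\<Prod>j = 1..n. 1 - a * q ^ (j - 1))"

(* Series in q and x are represented as power series in x whose coefficients are power
   series in q: q is fps_X :: rat fps, and x is fps_X :: rat fps fps. The coefficients are
   rational only so that division of power series in q is available.
   Sums of series are taken in the library's metric on power series in x, whose convergence
   implies coefficientwise convergence in q and x. *)

(* Hence the div 2 in the exponent below is exact. *)
lemma even_kr6_exponent: "even (9 * k ^ 2 + 7 * k :: nat)"
  by simp

definition kr6_summand :: "nat \<Rightarrow> nat \<Rightarrow> nat \<Rightarrow> rat fps fps" where
  "kr6_summand n1 n2 n3 =
     (let q = fps_X :: rat fps; x = fps_X :: rat fps fps in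
      fps_const
        (q ^ ((9 * n3 ^ 2 + 7 * n3) div 2 + 2 * n2 ^ 2 + 3 * n2 + n1 ^ 2 + n1
              + 6 * n3 * n2 + 3 * n3 * n1 + 2 * n2 * n1)
         * qpochhammer (- q) (q ^ 2) n2
         / (qpochhammer q q n1 * qpochhammer (q ^ 2) (q ^ 2) n2 * qpochhammer (q ^ 3) (q ^ 3) n3))
      * x ^ (3 * n3 + 2 * n2 + n1))"

end

theory Submission
  imports Defs
begin

text \<open>Write $x$ for the variable that counts parts and $q$ for the one that counts their sum,
and let $D_s$ be the generating function of the partitions with parts at least $s$, at most one of
them equal to $s$, that satisfy the conditions at distances two and three. The identity is proved by
showing that both sides belong to families of power series that satisfy the same linear
$q$-difference equation
$$D_s = (1 + xq^s)\, D_{s+1} + x^2 q^{2s+2} (1 + xq^s)\, D_{s+3} - x^4 q^{4s+5} D_{s+4},$$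
which has only one solution with constant term $1$ whose low coefficients vanish as $s$ grows
(\<open>kr_recurrence_unique\<close>). The left-hand side is $D_2$.

On the side of partitions, these conditions say that no part occurs more than twice, that a part
occurring twice excludes its successor, and that consecutive part sizes do not have the frequencies
$2,0,2$ or $1,1,2$. Let $A_s$ be the generating function without the restriction on the part $s$. If
$s$ occurs twice, what follows is counted by $D_{s+2}$, whence $A_s = D_s + x^2 q^{2s} D_{s+2}$. A
single part $s$ can be put in front of any admissible partition with parts at least $s+1$, unless
this one begins with $s+1, s+2, s+2$; what follows these three parts is counted by $D_{s+4}$. Hence
$D_s = A_{s+1} + xq^s (A_{s+1} - x^3 q^{3s+5} D_{s+4})$, and eliminating $A$ gives the equation.

On the side of the triple sum, let $S_{a,u,v}$ be the right-hand side with the additional factor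
$q^{(a-1) n_1 + 2 (u-1) n_2 + 3 (v-1) n_3}$ in each summand, so that the right-hand side itself is
$S_{1,1,1}$. Multiplying a summand by $1 - q^{n_1}$, $1 - q^{2n_2}$ or $1 - q^{3n_3}$ cancels one
factor of a denominator, so that shifting the index expresses $S_{a,u,v} - S_{a+1,u,v}$, $S_{a,u,v}
- S_{a,u+1,v}$ and $S_{a,u,v} - S_{a,u,v+1}$ by other members of the family
(\<open>kr_series_diff_1\<close>, \<open>kr_series_diff_2\<close>, \<open>kr_series_diff_3\<close>).
Eight instances of these three relations combine to the equation above for $D_{k+1} = S_{k,k,k}$
(\<open>kr_series_recurrence\<close>).\<close>

section \<open>A local description of the conditions on the parts\<close>

lemma all_nat_split_zero: "(\<forall>n. P n) \<longleftrightarrow> P 0 \<and> (\<forall>n. P (Suc n))"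
  by (metis not0_implies_Suc)

lemma diff_at_least_at_distance_Cons:
  "diff_at_least_at_distance k d (a # ps) \<longleftrightarrow>
     diff_at_least_at_distance k d ps \<and> (d \<le> length ps \<longrightarrow> (a # ps) ! d \<ge> a + k)"
  unfolding diff_at_least_at_distance_def
  by (subst all_nat_split_zero) (auto simp: less_Suc_eq_le)

lemma close_triples_cong_Cons:
  "close_triples_cong r (a # ps) \<longleftrightarrow>
     close_triples_cong r ps \<and>
     (2 \<le> length ps \<longrightarrow> ps ! 1 \<le> a + 1 \<longrightarrow> (a + ps ! 0 + ps ! 1) mod 3 = r mod 3)"
  unfolding close_triples_cong_def
  by (subst all_nat_split_zero) (auto simp: less_Suc_eq_le numeral_2_eq_2)

text \<open>Of the three weakly increasing triples with difference at most one, $(a,a,a)$,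
$(a,a,a+1)$ and $(a,a+1,a+1)$, only the last one has sum $2$ modulo $3$. This removes residues from
all later arguments.\<close>

lemma close_triple_cong_2_iff:
  fixes a b c :: nat
  assumes "a \<le> b" "b \<le> c"
  shows "(c \<le> a + 1 \<longrightarrow> (a + b + c) mod 3 = 2) \<longleftrightarrow> a < b \<or> a + 2 \<le> c"
proof -
  have "c \<ge> a + 2 \<or> (b = a \<and> c = a) \<or> (b = a \<and> c = a + 1) \<or> (b = a + 1 \<and> c = a + 1)"
    using assms by linarith
  moreover have "(a + a + a) mod 3 = 0" "(a + a + (a + 1)) mod 3 = 1"
    "(a + (a + 1) + (a + 1)) mod 3 = 2"
    by presburger+
  ultimately show ?thesis
    by (elim disjE conjE) simp_all
qed

definition admissible :: "nat list \<Rightarrow> bool" where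
  "admissible ps \<longleftrightarrow> sorted ps \<and> diff_at_least_at_distance 3 3 ps \<and> close_triples_cong 2 ps"

lemma admissible_short [simp]:
  "admissible []"
  "admissible [a]"
  "admissible [a, b] \<longleftrightarrow> a \<le> b"
  by (auto simp: admissible_def diff_at_least_at_distance_def close_triples_cong_def)

lemma admissible_triple [simp]:
  "admissible [a, b, c] \<longleftrightarrow> a \<le> b \<and> b \<le> c \<and> (a < b \<or> a + 2 \<le> c)"
proof -
  have "admissible [a, b, c] \<longleftrightarrow> a \<le> b \<and> b \<le> c \<and> (c \<le> a + 1 \<longrightarrow> (a + b + c) mod 3 = 2)"
    by (auto simp: admissible_def diff_at_least_at_distance_Cons close_triples_cong_Cons
        diff_at_least_at_distance_def[of _ _ "[]"] close_triples_cong_def[of _ "[]"])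
  thus ?thesis
    using close_triple_cong_2_iff[of a b c] by argo
qed

text \<open>With the congruence gone, adding a new smallest part only requires comparing it with the
next three parts. Together with the cases of short lists, simplification can compare a list with an
explicitly given beginning with its tails.\<close>

lemma admissible_Cons4 [simp]:
  "admissible (a # b # c # d # ps) \<longleftrightarrow>
     admissible (b # c # d # ps) \<and> a \<le> b \<and> (a < b \<or> a + 2 \<le> c) \<and> a + 3 \<le> d"
proof -
  have "admissible (a # b # c # d # ps) \<longleftrightarrow> admissible (b # c # d # ps) \<and> a \<le> b \<and>
          (c \<le> a + 1 \<longrightarrow> (a + b + c) mod 3 = 2) \<and> a + 3 \<le> d"
  proof -
    have nth3: "(a # b # c # d # ps) ! 3 = d"
      by (simp add: numeral_3_eq_3)
    have diff: "diff_at_least_at_distance 3 3 (a # b # c # d # ps) \<longleftrightarrow>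
            diff_at_least_at_distance 3 3 (b # c # d # ps) \<and> a + 3 \<le> d"
      unfolding diff_at_least_at_distance_Cons[of 3 3 a] nth3 by simp
    have close: "close_triples_cong 2 (a # b # c # d # ps) \<longleftrightarrow>
            close_triples_cong 2 (b # c # d # ps) \<and> (c \<le> a + 1 \<longrightarrow> (a + b + c) mod 3 = 2)"
      unfolding close_triples_cong_Cons[of 2 a] by simp
    have sorted: "sorted (a # b # c # d # ps) \<longleftrightarrow> sorted (b # c # d # ps) \<and> a \<le> b"
      by auto
    show ?thesis
      unfolding admissible_def diff close sorted by blast
  qed
  moreover have "b \<le> c" if "admissible (b # c # d # ps)"
    using that by (simp add: admissible_def)
  ultimately show ?thesis
    using close_triple_cong_2_iff[of a b c] by argo
qed

lemma admissible_sorted: "admissible ps \<Longrightarrow> sorted ps"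
  by (simp add: admissible_def)

section \<open>Splitting off the smallest parts\<close>

definition admissible_ge :: "nat \<Rightarrow> nat list set" where
  "admissible_ge s = {ps. admissible ps \<and> (\<forall>p\<in>set ps. s \<le> p)}"

text \<open>For the sorted lists at hand, at most one part equals \<open>s\<close> exactly if the
list does not begin with two parts \<open>s\<close>; the formulation by a prefix is the one that the
decompositions need.\<close>

definition admissible_ge_once :: "nat \<Rightarrow> nat list set" where
  "admissible_ge_once s = {ps \<in> admissible_ge s. \<not> (\<exists>r. ps = s # s # r)}"

lemma admissible_ge_Nil [simp]: "[] \<in> admissible_ge s"
  by (simp add: admissible_ge_def)

lemma admissible_ge_Cons [simp]:
  "a # ps \<in> admissible_ge s \<longleftrightarrow> admissible (a # ps) \<and> s \<le> a"
  using admissible_sorted[of "a # ps"] by (fastforce simp: admissible_ge_def)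

text \<open>After \<open>s, s\<close> the close-triple condition rules out \<open>s\<close> and
\<open>s + 1\<close>, and two parts \<open>s + 2\<close> would be at distance three from the first
\<open>s\<close> with difference only two.\<close>

lemma double_append_in_admissible_ge:
  "[s, s] @ r \<in> admissible_ge s \<longleftrightarrow> r \<in> admissible_ge_once (s + 2)"
proof -
  consider "r = []" | c where "r = [c]" | c d where "r = [c, d]" | c d e l where "r = c # d # e # l"
    by (metis list.exhaust)
  thus ?thesis
  proof cases
    case 4
    have "c \<le> d \<and> d \<le> e" if "admissible (c # d # e # l)"
      using admissible_sorted[OF that] by simp
    thus ?thesis using 4 by (auto simp: admissible_ge_once_def)
  qed (auto simp: admissible_ge_once_def)
qed

lemma admissible_ge_eq:
  "admissible_ge s = admissible_ge_once s \<union> (\<lambda>r. [s, s] @ r) ` admissible_ge_once (s + 2)"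
  using double_append_in_admissible_ge[of s] by (auto simp: admissible_ge_once_def)

text \<open>The two sets correspond to zero or one part \<open>s\<close>.\<close>

lemma admissible_ge_once_eq:
  "admissible_ge_once s =
     admissible_ge (Suc s) \<union> (\<lambda>r. [s] @ r) ` {r \<in> admissible_ge (Suc s). admissible (s # r)}"
proof (intro set_eqI)
  fix ps
  show "ps \<in> admissible_ge_once s \<longleftrightarrow> ps \<in> admissible_ge (Suc s) \<union>
          (\<lambda>r. [s] @ r) ` {r \<in> admissible_ge (Suc s). admissible (s # r)}"
  proof (cases ps)
    case (Cons a l)
    show ?thesis
    proof (cases l)
      case Nil
      thus ?thesis using Cons by (auto simp: admissible_ge_once_def image_iff)
    next
      case (Cons b l')
      have "a \<le> b \<and> admissible l" if "admissible (a # l)"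
        using that unfolding Cons admissible_def
        by (auto simp: diff_at_least_at_distance_Cons close_triples_cong_Cons)
      thus ?thesis using \<open>ps = a # l\<close> Cons
        by (cases "a = s") (auto simp: admissible_ge_once_def image_iff)
    qed
  qed (auto simp: admissible_ge_once_def)
qed

text \<open>The repeated part \<open>s + 2\<close> acts on the rest as in
\<open>double_append_in_admissible_ge\<close>. The part \<open>s + 1\<close> only forces the next
part to be at least \<open>s + 4\<close>, which the double part does already.\<close>

lemma staircase_append_in_admissible_ge:
  "[s + 1, s + 2, s + 2] @ r \<in> admissible_ge (Suc s) \<longleftrightarrow> r \<in> admissible_ge_once (s + 4)"
proof -
  consider "r = []" | c where "r = [c]" | c d where "r = [c, d]" | c d e l where "r = c # d # e # l"
    by (metis list.exhaust)
  thus ?thesis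
  proof cases
    case 4
    have "c \<le> d \<and> d \<le> e" if "admissible (c # d # e # l)"
      using admissible_sorted[OF that] by simp
    thus ?thesis using 4 by (auto simp: admissible_ge_once_def)
  qed (auto simp: admissible_ge_once_def)
qed

text \<open>A single \<open>s\<close> can fail to fit in front of parts \<open>b \<le> c \<le>
d\<close>, all larger than \<open>s\<close>, only because of \<open>d \<le> s + 2\<close>. Then
\<open>b, c, d\<close> is a close triple, which leaves only \<open>s + 1, s + 2, s + 2\<close>.\<close>

lemma admissible_ge_Suc_eq:
  "admissible_ge (Suc s) = {r \<in> admissible_ge (Suc s). admissible (s # r)} \<union>
     (\<lambda>r. [s + 1, s + 2, s + 2] @ r) ` admissible_ge_once (s + 4)"
proof -
  have "\<exists>l. ps = [s + 1, s + 2, s + 2] @ l"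
    if ps: "ps \<in> admissible_ge (Suc s)" and bad: "\<not> admissible (s # ps)" for ps
  proof -
    consider "ps = []" | b where "ps = [b]" | b c where "ps = [b, c]"
      | b c d l where "ps = b # c # d # l"
      by (metis list.exhaust)
    thus ?thesis
    proof cases
      case 4
      with ps have adm: "admissible (b # c # d # l)" and "s < b"
        by simp_all
      with bad 4 have "d < s + 3"
        by simp
      moreover have "b \<le> c" "c \<le> d"
        using admissible_sorted[OF adm] by simp_all
      moreover have "b < c \<or> b + 2 \<le> d"
        using adm by (cases l) simp_all
      ultimately have "b = s + 1 \<and> c = s + 2 \<and> d = s + 2"
        using \<open>s < b\<close> by linarith
      thus ?thesis using 4 by simp
    qed (use ps bad in auto)
  qed
  thus ?thesis
    using staircase_append_in_admissible_ge[of s] by (auto simp del: append_Cons)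
qed

section \<open>A recurrence in the lower bound of the parts\<close>

text \<open>The index \<open>k\<close> corresponds to partitions with parts at least \<open>k +
1\<close>, so that it agrees with the parameters of the triple sums below.\<close>

definition kr_recurrence :: "(nat \<Rightarrow> rat fps fps) \<Rightarrow> bool" where
  "kr_recurrence F \<longleftrightarrow> (\<forall>k. F k =
     (1 + fps_X * fps_const fps_X ^ (k + 1)) * F (k + 1)
     + fps_X\<^sup>2 * fps_const fps_X ^ (2 * k + 4) * (1 + fps_X * fps_const fps_X ^ (k + 1)) * F (k + 3)
     - fps_X ^ 4 * fps_const fps_X ^ (4 * k + 9) * F (k + 4))"

lemma fps_nth_X_mult_eq_0:
  fixes h :: "'a::comm_ring_1 fps"
  assumes "\<And>i. i < m \<Longrightarrow> fps_nth h i = 0"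
  shows "fps_nth (fps_X * c * h) m = 0"
proof -
  have "fps_nth (c * h) (m - 1) = 0" if "m > 0"
    using that assms by (auto simp: fps_mult_nth intro!: sum.neutral)
  thus ?thesis
    by (simp add: mult.assoc)
qed

text \<open>The difference \<open>H\<close> of two solutions satisfies the same recurrence, in which
all terms but one copy of \<open>H (k + 1)\<close> carry a factor $x$. By induction on the exponent
of $x$ they contribute nothing, so that a coefficient of \<open>H k\<close> does not depend on
\<open>k\<close>; it vanishes because it does so for large \<open>k\<close>.\<close>

lemma kr_recurrence_unique:
  assumes F: "kr_recurrence F" and G: "kr_recurrence G"
    and zero: "\<And>k. fps_nth (F k) 0 = fps_nth (G k) 0"
    and low: "\<And>k m n. m > 0 \<Longrightarrow> n < k \<Longrightarrow> fps_nth (fps_nth (F k) m) n = fps_nth (fps_nth (G k) m) n"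
  shows "F k = G k"
proof -
  define H where "H k = F k - G k" for k
  have H_rec: "H k = H (k + 1) + fps_X * fps_const fps_X ^ (k + 1) * H (k + 1)
     + fps_X * (fps_X * fps_const fps_X ^ (2 * k + 4) * (1 + fps_X * fps_const fps_X ^ (k + 1))) * H (k + 3)
     - fps_X * (fps_X ^ 3 * fps_const fps_X ^ (4 * k + 9)) * H (k + 4)" for k
    using F[unfolded kr_recurrence_def, rule_format, of k] G[unfolded kr_recurrence_def, rule_format, of k]
    unfolding H_def
    by (simp only: power2_eq_square power3_eq_cube power4_eq_xxxx) (simp only: algebra_simps mult_1_left mult_1_right)
  have "fps_nth (H k) m = 0" for k m
  proof (induction m arbitrary: k rule: less_induct)
    case (less m)
    have step: "fps_nth (H k) m = fps_nth (H (k + 1)) m" for k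
    proof -
      have "fps_nth (fps_X * c * H j) m = 0" for c j
        using less by (intro fps_nth_X_mult_eq_0)
      thus ?thesis
        by (subst H_rec) (simp only: fps_add_nth fps_sub_nth add_0_right diff_0_right)
    qed
    have shift: "fps_nth (H k) m = fps_nth (H (k + j)) m" for j
      by (induction j) (use step in auto)
    show ?case
    proof (cases "m = 0")
      case True
      thus ?thesis by (simp add: H_def zero)
    next
      case False
      show ?thesis
      proof (rule fps_ext)
        fix n
        have "fps_nth (fps_nth (H k) m) n = fps_nth (fps_nth (H (k + Suc n)) m) n"
          using shift by metis
        also have "\<dots> = 0"
          using False low[of m n "k + Suc n"] by (simp add: H_def)
        finally show "fps_nth (fps_nth (H k) m) n = fps_nth 0 n" by simp
      qed
    qed
  qed
  hence "H k = 0"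
    by (simp add: fps_eq_iff)
  thus ?thesis by (simp add: H_def)
qed

section \<open>The recurrence for the partitions\<close>

definition partition_gf :: "nat list set \<Rightarrow> rat fps fps" where
  "partition_gf X = Abs_fps (\<lambda>m. Abs_fps (\<lambda>n. of_nat (card {ps \<in> X. sum_list ps = n \<and> length ps = m})))"

lemma finite_fixed_sum_length: "finite {ps \<in> X. sum_list ps = n \<and> length ps = m}" for n m :: nat
proof (rule finite_subset)
  show "{ps \<in> X. sum_list ps = n \<and> length ps = m} \<subseteq> {ps. set ps \<subseteq> {..n} \<and> length ps = m}"
    by (auto dest: member_le_sum_list)
  show "finite {ps. set ps \<subseteq> {..n} \<and> length ps = m}"
    by (rule finite_lists_length_eq) simp
qed

lemma partition_gf_Un:
  assumes "X \<inter> Y = {}"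
  shows "partition_gf (X \<union> Y) = partition_gf X + partition_gf Y"
proof -
  have "card {ps \<in> X \<union> Y. sum_list ps = n \<and> length ps = m} =
        card {ps \<in> X. sum_list ps = n \<and> length ps = m} +
        card {ps \<in> Y. sum_list ps = n \<and> length ps = m}" for n m
  proof -
    have "{ps \<in> X \<union> Y. sum_list ps = n \<and> length ps = m} =
          {ps \<in> X. sum_list ps = n \<and> length ps = m} \<union> {ps \<in> Y. sum_list ps = n \<and> length ps = m}"
      by blast
    thus ?thesis
      using assms by (subst card_Un_disjoint[symmetric]) (auto intro: finite_fixed_sum_length)
  qed
  thus ?thesis
    by (simp add: partition_gf_def fps_eq_iff)
qed

lemma partition_gf_append_image:
  "partition_gf ((\<lambda>r. p @ r) ` X) = fps_X ^ length p * fps_const fps_X ^ sum_list p * partition_gf X"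
proof -
  have card_eq: "card {ps \<in> (\<lambda>r. p @ r) ` X. sum_list ps = n \<and> length ps = m} =
        (if length p \<le> m \<and> sum_list p \<le> n
         then card {ps \<in> X. sum_list ps = n - sum_list p \<and> length ps = m - length p} else 0)"
    for n m
  proof (cases "length p \<le> m \<and> sum_list p \<le> n")
    case True
    hence "{ps \<in> (\<lambda>r. p @ r) ` X. sum_list ps = n \<and> length ps = m} =
      (\<lambda>r. p @ r) ` {ps \<in> X. sum_list ps = n - sum_list p \<and> length ps = m - length p}"
      by auto
    thus ?thesis using True by (simp add: card_image inj_on_def)
  next
    case False
    hence "{ps \<in> (\<lambda>r. p @ r) ` X. sum_list ps = n \<and> length ps = m} = {}"
      by auto
    thus ?thesis using False by (metis card.empty)
  qed
  show ?thesis
    by (rule fps_ext)+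
       (auto simp: partition_gf_def card_eq fps_X_power_mult_nth mult.assoc fps_const_power)
qed

text \<open>The functional equation results from eliminating the generating function of
\<open>admissible_ge (Suc s)\<close> from the three decompositions.\<close>

lemma partition_gf_admissible_ge_once:
  "partition_gf (admissible_ge_once s) =
     (1 + fps_X * fps_const fps_X ^ s) * partition_gf (admissible_ge_once (Suc s))
     + fps_X\<^sup>2 * fps_const fps_X ^ (2 * s + 2) * (1 + fps_X * fps_const fps_X ^ s)
         * partition_gf (admissible_ge_once (s + 3))
     - fps_X ^ 4 * fps_const fps_X ^ (4 * s + 5) * partition_gf (admissible_ge_once (s + 4))"
proof -
  define E where "E = {r \<in> admissible_ge (Suc s). admissible (s # r)}"
  let ?x = "fps_X :: rat fps fps" and ?q = "fps_const fps_X :: rat fps fps"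
  have A: "partition_gf (admissible_ge (Suc s)) =
             partition_gf (admissible_ge_once (Suc s)) + ?x ^ 2 * ?q ^ (2 * s + 2) * partition_gf (admissible_ge_once (s + 3))"
    by (subst admissible_ge_eq, subst partition_gf_Un, force simp: admissible_ge_once_def, subst partition_gf_append_image)
       (simp add: eval_nat_numeral)
  have D: "partition_gf (admissible_ge_once s) = partition_gf (admissible_ge (Suc s)) + ?x * ?q ^ s * partition_gf E"
    by (subst admissible_ge_once_eq, subst partition_gf_Un, force, subst partition_gf_append_image) (simp add: E_def)
  have E: "partition_gf (admissible_ge (Suc s)) =
             partition_gf E + ?x ^ 3 * ?q ^ (3 * s + 5) * partition_gf (admissible_ge_once (s + 4))"
    by (subst admissible_ge_Suc_eq, subst partition_gf_Un, force simp: E_def, subst partition_gf_append_image)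
       (simp add: E_def eval_nat_numeral)
  have "partition_gf (admissible_ge_once s) =
     (1 + ?x * ?q ^ s) * partition_gf (admissible_ge (Suc s))
     - ?x ^ 4 * ?q ^ (4 * s + 5) * partition_gf (admissible_ge_once (s + 4))"
    using D E by (simp add: algebra_simps power_add power_mult eval_nat_numeral)
  thus ?thesis
    unfolding A by (simp add: algebra_simps)
qed

lemma partition_gf_recurrence:
  "kr_recurrence (\<lambda>k. partition_gf (admissible_ge_once (k + 1)))"
  unfolding kr_recurrence_def
proof
  fix k
  have e: "2 * (k + 1) + 2 = 2 * k + 4" "4 * (k + 1) + 5 = 4 * k + 9" "Suc (k + 1) = k + 1 + 1"
    "k + 1 + 3 = k + 3 + 1" "k + 1 + 4 = k + 4 + 1"
    by simp_all
  show "partition_gf (admissible_ge_once (k + 1)) =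
     (1 + fps_X * fps_const fps_X ^ (k + 1)) * partition_gf (admissible_ge_once (k + 1 + 1))
     + fps_X\<^sup>2 * fps_const fps_X ^ (2 * k + 4) * (1 + fps_X * fps_const fps_X ^ (k + 1))
         * partition_gf (admissible_ge_once (k + 3 + 1))
     - fps_X ^ 4 * fps_const fps_X ^ (4 * k + 9) * partition_gf (admissible_ge_once (k + 4 + 1))"
    using partition_gf_admissible_ge_once[of "k + 1"] unfolding e .
qed

lemma partition_gf_nth_0: "fps_nth (partition_gf (admissible_ge_once s)) 0 = 1"
proof (rule fps_ext)
  fix n
  have "{ps \<in> admissible_ge_once s. sum_list ps = n \<and> length ps = 0} = (if n = 0 then {[]} else {})"
    by (auto simp: admissible_ge_once_def)
  hence "card {ps \<in> admissible_ge_once s. sum_list ps = n \<and> length ps = 0} = (if n = 0 then 1 else 0)"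
    by simp
  thus "fps_nth (fps_nth (partition_gf (admissible_ge_once s)) 0) n = fps_nth 1 n"
    by (simp add: partition_gf_def)
qed

lemma partition_gf_nth_low:
  assumes "m > 0" "n < s"
  shows "fps_nth (fps_nth (partition_gf (admissible_ge_once s)) m) n = 0"
proof -
  have "sum_list ps \<noteq> n" if "ps \<in> admissible_ge_once s" "length ps = m" for ps
    using that assms by (cases ps) (auto simp: admissible_ge_once_def)
  hence "{ps \<in> admissible_ge_once s. sum_list ps = n \<and> length ps = m} = {}"
    by blast
  thus ?thesis
    unfolding partition_gf_def by (simp only: fps_nth_Abs_fps card.empty of_nat_0)
qed

section \<open>Power series given by triple sums\<close>

fun weight :: "nat \<times> nat \<times> nat \<Rightarrow> nat" where
  "weight (n1, n2, n3) = 3 * n3 + 2 * n2 + n1"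

lemma finite_weight_eq: "finite {t. weight t = m}"
proof (rule finite_subset)
  show "{t. weight t = m} \<subseteq> {..m} \<times> {..m} \<times> {..m}"
    by auto
qed auto

definition series_by_weight :: "(nat \<times> nat \<times> nat \<Rightarrow> rat fps) \<Rightarrow> rat fps fps" where
  "series_by_weight f = Abs_fps (\<lambda>m. \<Sum>t | weight t = m. f t)"

text \<open>Only finitely many triples have a given weight, so each coefficient of the partial sums
is eventually constant.\<close>

lemma series_by_weight_has_sum:
  "((\<lambda>t. fps_const (f t) * fps_X ^ weight t) has_sum series_by_weight f) UNIV"
  unfolding has_sum_def
proof (rule tendsto_fpsI)
  fix m
  have "fps_nth (\<Sum>t\<in>Y. fps_const (f t) * fps_X ^ weight t) m = fps_nth (series_by_weight f) m"
    if Y: "finite Y" "{t. weight t = m} \<subseteq> Y" for Y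
  proof -
    have "fps_nth (\<Sum>t\<in>Y. fps_const (f t) * fps_X ^ weight t) m = (\<Sum>t\<in>Y. if weight t = m then f t else 0)"
      by (simp add: fps_sum_nth eq_commute if_distrib cong: if_cong)
    also have "\<dots> = (\<Sum>t | weight t = m. f t)"
      using Y by (intro sum.mono_neutral_cong_right) auto
    finally show ?thesis
      by (simp add: series_by_weight_def)
  qed
  thus "\<forall>\<^sub>F Y in finite_subsets_at_top UNIV.
          fps_nth (\<Sum>t\<in>Y. fps_const (f t) * fps_X ^ weight t) m = fps_nth (series_by_weight f) m"
    using finite_weight_eq[of m] by (auto simp: eventually_finite_subsets_at_top)
qed

lemma series_by_weight_diff:
  "series_by_weight f - series_by_weight g = series_by_weight (\<lambda>t. f t - g t)"
  by (simp add: series_by_weight_def fps_eq_iff sum_subtractf)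

lemma series_by_weight_add:
  "series_by_weight f + series_by_weight g = series_by_weight (\<lambda>t. f t + g t)"
  by (simp add: series_by_weight_def fps_eq_iff sum.distrib)

lemma series_by_weight_mult_q_power:
  "fps_const fps_X ^ e * series_by_weight f = series_by_weight (\<lambda>t. fps_X ^ e * f t)"
  by (simp add: series_by_weight_def fps_eq_iff sum_distrib_left)

text \<open>A summand that vanishes where an index is $0$ allows this index to be shifted by one.
The map \<open>inc\<close> raises the index in question, and \<open>w\<close> is its contribution to
the exponent of $x$.\<close>

lemma series_by_weight_shift:
  assumes inj: "inj inc"
    and weight: "\<And>t. weight (inc t) = weight t + w"
    and zero: "\<And>t. t \<notin> range inc \<Longrightarrow> f t = 0"
  shows "series_by_weight f = fps_X ^ w * series_by_weight (\<lambda>t. f (inc t))"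
proof (rule fps_ext)
  fix m
  show "fps_nth (series_by_weight f) m = fps_nth (fps_X ^ w * series_by_weight (\<lambda>t. f (inc t))) m"
  proof (cases "m < w")
    case True
    have "f t = 0" if "weight t = m" for t
      using zero[of t] weight that True by (cases "t \<in> range inc") auto
    thus ?thesis using True by (simp add: series_by_weight_def fps_X_power_mult_nth)
  next
    case False
    have "(\<Sum>t | weight t = m. f t) = (\<Sum>t\<in>inc ` {t. weight t = m - w}. f t)"
    proof (rule sum.mono_neutral_right)
      show "\<forall>t\<in>{t. weight t = m} - inc ` {t. weight t = m - w}. f t = 0"
      proof
        fix t assume t: "t \<in> {t. weight t = m} - inc ` {t. weight t = m - w}"
        have "t \<notin> range inc"
          using t weight by auto
        thus "f t = 0" by (rule zero)
      qed
    qed (use False weight finite_weight_eq in auto)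
    also have "\<dots> = (\<Sum>t | weight t = m - w. f (inc t))"
      using inj by (subst sum.reindex) (auto simp: inj_on_def)
    finally show ?thesis
      using False by (simp add: series_by_weight_def fps_X_power_mult_nth)
  qed
qed

section \<open>The recurrence for the triple sum\<close>

text \<open>The exponent in the theorem is the case \<open>a = u = v = 1\<close>. The factors
\<open>2\<close> and \<open>3\<close> of \<open>u\<close> and \<open>v\<close> make the substitution
of $xq$ for $x$ increase all three parameters by one.\<close>

fun kr_exponent :: "nat \<Rightarrow> nat \<Rightarrow> nat \<Rightarrow> nat \<times> nat \<times> nat \<Rightarrow> nat" where
  "kr_exponent a u v (n1, n2, n3) =
     (9 * n3 ^ 2 + n3) div 2 + 2 * n2 ^ 2 + n2 + n1 ^ 2
     + 6 * n3 * n2 + 3 * n3 * n1 + 2 * n2 * n1 + a * n1 + 2 * u * n2 + 3 * v * n3"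

definition inv_qpoch :: "nat \<Rightarrow> nat \<Rightarrow> rat fps" where
  "inv_qpoch j n = inverse (qpochhammer (fps_X ^ j) (fps_X ^ j) n)"

lemma qpochhammer_Suc: "qpochhammer a q (Suc n) = qpochhammer a q n * (1 - a * q ^ n)"
  by (simp add: qpochhammer_def)

lemma qpochhammer_0 [simp]: "qpochhammer a q 0 = 1"
  by (simp add: qpochhammer_def)

lemma inv_qpoch_0 [simp]: "inv_qpoch j 0 = 1"
  by (simp add: inv_qpoch_def)

lemma inv_qpoch_Suc:
  assumes "j > 0"
  shows "inv_qpoch j (Suc n) * (1 - fps_X ^ (j * Suc n)) = inv_qpoch j n"
proof -
  have "inv_qpoch j (Suc n) = inv_qpoch j n * inverse (1 - fps_X ^ (j * Suc n))"
    unfolding inv_qpoch_def qpochhammer_Suc fps_inverse_mult by (simp add: power_add power_mult)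
  moreover have "inverse (1 - fps_X ^ (j * Suc n)) * (1 - fps_X ^ (j * Suc n) :: rat fps) = 1"
    using assms by (intro inverse_mult_eq_1) simp
  ultimately show ?thesis
    by (simp add: mult.assoc)
qed

fun kr_coeff :: "nat \<Rightarrow> nat \<Rightarrow> nat \<Rightarrow> nat \<times> nat \<times> nat \<Rightarrow> rat fps" where
  "kr_coeff a u v (n1, n2, n3) =
     fps_X ^ kr_exponent a u v (n1, n2, n3)
     * (qpochhammer (- fps_X) (fps_X ^ 2) n2 * inv_qpoch 1 n1 * inv_qpoch 2 n2 * inv_qpoch 3 n3)"

definition kr_series :: "nat \<Rightarrow> nat \<Rightarrow> nat \<Rightarrow> rat fps fps" where
  "kr_series a u v = series_by_weight (kr_coeff a u v)"

lemma half_exponent_Suc: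
  "(9 * (Suc n)\<^sup>2 + Suc n) div 2 = (9 * n\<^sup>2 + n) div 2 + 9 * n + 5"
proof -
  have "9 * (Suc n)\<^sup>2 + Suc n = (9 * n\<^sup>2 + n) + (9 * n + 5) * 2"
    by (simp add: power2_eq_square)
  thus ?thesis
    by (metis div_mult_self1 zero_neq_numeral add.assoc add.commute)
qed

lemma qpochhammer_neg_Suc:
  "qpochhammer (- fps_X) (fps_X ^ 2) (Suc n) =
     qpochhammer (- fps_X) (fps_X ^ 2) n * (1 + fps_X ^ (2 * n + 1) :: rat fps)"
  by (simp add: qpochhammer_Suc power_mult)

text \<open>The difference multiplies each summand by $1 - q^{n_1}$, which vanishes for $n_1 = 0$
and otherwise cancels the last factor of $(q;q)_{n_1}$. Replacing $n_1$ by $n_1 + 1$ then raises the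
quadratic exponent by a linear form in the indices, which is absorbed by the parameters.\<close>

lemma kr_series_diff_1:
  "kr_series a u v - kr_series (a + 1) u v =
     fps_X * fps_const fps_X ^ (a + 1) * kr_series (a + 2) (u + 1) (v + 1)"
proof -
  define f where "f = (\<lambda>t. kr_coeff a u v t - kr_coeff (a + 1) u v t)"
  define inc where "inc = (\<lambda>(n1 :: nat, n2 :: nat, n3 :: nat). (Suc n1, n2, n3))"
  have f_eq: "f (n1, n2, n3) = kr_coeff a u v (n1, n2, n3) * (1 - fps_X ^ n1)" for n1 n2 n3
  proof -
    have e: "kr_exponent (a + 1) u v (n1, n2, n3) = kr_exponent a u v (n1, n2, n3) + n1"
      by (simp add: algebra_simps)
    show ?thesis
      unfolding f_def kr_coeff.simps e by (simp only: power_add algebra_simps mult_1_left mult_1_right)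
  qed
  have zero: "f t = 0" if "t \<notin> range inc" for t
  proof (cases t)
    case (fields n1 n2 n3)
    have "n1 = 0"
      using that fields by (cases n1) (auto simp: inc_def image_iff)
    thus ?thesis
      using fields f_eq by simp
  qed
  have step: "f (inc t) = fps_X ^ (a + 1) * kr_coeff (a + 2) (u + 1) (v + 1) t" for t
  proof (cases t)
    case (fields n1 n2 n3)
    have e: "kr_exponent a u v (Suc n1, n2, n3) =
            (a + 1) + kr_exponent (a + 2) (u + 1) (v + 1) (n1, n2, n3)"
      by (simp add: power2_eq_square algebra_simps)
    have inv: "inv_qpoch 1 (Suc n1) * (1 - fps_X ^ Suc n1) = inv_qpoch 1 n1"
      using inv_qpoch_Suc[of 1 n1] by simp
    show ?thesis
      unfolding fields inc_def prod.case f_eq kr_coeff.simps e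
      unfolding inv[symmetric]
      by (simp only: power_add mult_ac)
  qed
  have "kr_series a u v - kr_series (a + 1) u v = series_by_weight f"
    by (simp only: kr_series_def series_by_weight_diff f_def)
  also have "\<dots> = fps_X ^ 1 * series_by_weight (\<lambda>t. f (inc t))"
    using zero by (intro series_by_weight_shift) (auto simp: inc_def inj_on_def)
  finally show ?thesis
    by (simp only: step kr_series_def series_by_weight_mult_q_power[symmetric] power_one_right mult.assoc)
qed

text \<open>As before, now with $1 - q^{2n_2}$. There are two terms on the right because the shift
of $n_2$ also produces a new factor $1 + q^{2n_2+1}$ of $(-q;q^2)_{n_2}$.\<close>

lemma kr_series_diff_2:
  "kr_series a u v - kr_series a (u + 1) v =
     fps_X ^ 2 * fps_const fps_X ^ (2 * u + 3) *
       (kr_series (a + 2) (u + 2) (v + 2) + fps_const fps_X * kr_series (a + 2) (u + 3) (v + 2))"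
proof -
  define f where "f = (\<lambda>t. kr_coeff a u v t - kr_coeff a (u + 1) v t)"
  define g where "g = (\<lambda>t. kr_coeff (a + 2) (u + 2) (v + 2) t
    + fps_X ^ 1 * kr_coeff (a + 2) (u + 3) (v + 2) t)"
  define inc where "inc = (\<lambda>(n1 :: nat, n2 :: nat, n3 :: nat). (n1, Suc n2, n3))"
  have f_eq: "f (n1, n2, n3) = kr_coeff a u v (n1, n2, n3) * (1 - fps_X ^ (2 * n2))" for n1 n2 n3
  proof -
    have e: "kr_exponent a (u + 1) v (n1, n2, n3) = kr_exponent a u v (n1, n2, n3) + 2 * n2"
      by (simp add: algebra_simps)
    show ?thesis
      unfolding f_def kr_coeff.simps e by (simp only: power_add algebra_simps mult_1_left mult_1_right)
  qed
  have zero: "f t = 0" if "t \<notin> range inc" for t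
  proof (cases t)
    case (fields n1 n2 n3)
    have "n2 = 0"
      using that fields by (cases n2) (auto simp: inc_def image_iff)
    thus ?thesis
      using fields f_eq by simp
  qed
  have step: "f (inc t) = fps_X ^ (2 * u + 3) * g t" for t
  proof (cases t)
    case (fields n1 n2 n3)
    have e: "kr_exponent a u v (n1, Suc n2, n3) =
            (2 * u + 3) + kr_exponent (a + 2) (u + 2) (v + 2) (n1, n2, n3)"
      by (simp add: power2_eq_square algebra_simps)
    have e': "kr_exponent (a + 2) (u + 3) (v + 2) (n1, n2, n3) =
            kr_exponent (a + 2) (u + 2) (v + 2) (n1, n2, n3) + 2 * n2"
      by (simp add: algebra_simps)
    have g_eq: "g (n1, n2, n3) =
            kr_coeff (a + 2) (u + 2) (v + 2) (n1, n2, n3) * (1 + fps_X ^ (2 * n2 + 1))"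
      unfolding g_def kr_coeff.simps e' by (simp only: power_add algebra_simps mult_1_left mult_1_right)
    have inv: "inv_qpoch 2 (Suc n2) * (1 - fps_X ^ (2 * Suc n2)) = inv_qpoch 2 n2"
      using inv_qpoch_Suc[of 2 n2] by simp
    show ?thesis
      unfolding fields inc_def prod.case f_eq g_eq kr_coeff.simps e qpochhammer_neg_Suc
      unfolding inv[symmetric]
      by (simp only: power_add mult_ac)
  qed
  have "kr_series a u v - kr_series a (u + 1) v = series_by_weight f"
    by (simp only: kr_series_def series_by_weight_diff f_def)
  also have "\<dots> = fps_X ^ 2 * series_by_weight (\<lambda>t. f (inc t))"
    using zero by (intro series_by_weight_shift) (auto simp: inc_def inj_on_def)
  also have "\<dots> = fps_X ^ 2 * fps_const fps_X ^ (2 * u + 3) * series_by_weight g"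
    by (simp only: step series_by_weight_mult_q_power[symmetric] mult.assoc)
  also have "series_by_weight g =
      kr_series (a + 2) (u + 2) (v + 2) + fps_const fps_X * kr_series (a + 2) (u + 3) (v + 2)"
    unfolding g_def kr_series_def series_by_weight_add[symmetric]
      series_by_weight_mult_q_power[symmetric] by simp
  finally show ?thesis .
qed

text \<open>As for $n_1$, now with $1 - q^{3n_3}$.\<close>

lemma kr_series_diff_3:
  "kr_series a u v - kr_series a u (v + 1) =
     fps_X ^ 3 * fps_const fps_X ^ (3 * v + 5) * kr_series (a + 3) (u + 3) (v + 3)"
proof -
  define f where "f = (\<lambda>t. kr_coeff a u v t - kr_coeff a u (v + 1) t)"
  define inc where "inc = (\<lambda>(n1 :: nat, n2 :: nat, n3 :: nat). (n1, n2, Suc n3))"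
  have f_eq: "f (n1, n2, n3) = kr_coeff a u v (n1, n2, n3) * (1 - fps_X ^ (3 * n3))" for n1 n2 n3
  proof -
    have e: "kr_exponent a u (v + 1) (n1, n2, n3) = kr_exponent a u v (n1, n2, n3) + 3 * n3"
      by (simp add: algebra_simps)
    show ?thesis
      unfolding f_def kr_coeff.simps e by (simp only: power_add algebra_simps mult_1_left mult_1_right)
  qed
  have zero: "f t = 0" if "t \<notin> range inc" for t
  proof (cases t)
    case (fields n1 n2 n3)
    have "n3 = 0"
      using that fields by (cases n3) (auto simp: inc_def image_iff)
    thus ?thesis
      using fields f_eq by simp
  qed
  have step: "f (inc t) = fps_X ^ (3 * v + 5) * kr_coeff (a + 3) (u + 3) (v + 3) t" for t
  proof (cases t)
    case (fields n1 n2 n3)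
    have e: "kr_exponent a u v (n1, n2, Suc n3) =
            (3 * v + 5) + kr_exponent (a + 3) (u + 3) (v + 3) (n1, n2, n3)"
      unfolding kr_exponent.simps half_exponent_Suc
      by (simp add: algebra_simps)
    have inv: "inv_qpoch 3 (Suc n3) * (1 - fps_X ^ (3 * Suc n3)) = inv_qpoch 3 n3"
      using inv_qpoch_Suc[of 3 n3] by simp
    show ?thesis
      unfolding fields inc_def prod.case f_eq kr_coeff.simps e
      unfolding inv[symmetric]
      by (simp only: power_add mult_ac)
  qed
  have "kr_series a u v - kr_series a u (v + 1) = series_by_weight f"
    by (simp only: kr_series_def series_by_weight_diff f_def)
  also have "\<dots> = fps_X ^ 3 * series_by_weight (\<lambda>t. f (inc t))"
    using zero by (intro series_by_weight_shift) (auto simp: inc_def inj_on_def)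
  finally show ?thesis
    by (simp only: step kr_series_def series_by_weight_mult_q_power[symmetric] mult.assoc)
qed

text \<open>The proof walks from $S_{k,k,k}$ to $S_{k+1,k+1,k+1}$ by changing one parameter at a
time, and likewise brings the resulting correction terms to equal parameters. What remains of the
form $S_{k+6,k+5,k+5}$ and $S_{k+6,k+6,k+5}$ cancels.\<close>

lemma kr_series_recurrence: "kr_recurrence (\<lambda>k. kr_series k k k)"
  unfolding kr_recurrence_def
proof
  fix k
  let ?S = "\<lambda>a u v. kr_series (k + a) (k + u) (k + v)"
  define x where "x = (fps_X :: rat fps fps)"
  define q where "q = (fps_const fps_X :: rat fps fps)"
  define p where "p = q ^ k"
  \<comment> \<open>Each relation is solved for the term to be eliminated; the terms left are those with the
    parameters 111, 333, 444 above \<open>k\<close>, which the claim contains, and 322, 655, 665, which cancel.\<close>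
  have r1: "?S 0 0 0 = ?S 1 0 0 + x * q * p * ?S 2 1 1"
    using kr_series_diff_1[of k k k] by (simp add: p_def q_def x_def algebra_simps)
  have r2: "?S 2 1 1 = ?S 1 1 1 - x * q ^ 2 * p * ?S 3 2 2"
    using kr_series_diff_1[of "k + 1" "k + 1" "k + 1"]
    by (simp add: p_def q_def x_def algebra_simps eval_nat_numeral)
  have r3: "?S 4 3 3 = ?S 3 3 3 - x * q ^ 4 * p * ?S 5 4 4"
    using kr_series_diff_1[of "k + 3" "k + 3" "k + 3"]
    by (simp add: p_def q_def x_def algebra_simps eval_nat_numeral)
  have r4: "?S 5 4 4 = ?S 4 4 4 - x * q ^ 5 * p * ?S 6 5 5"
    using kr_series_diff_1[of "k + 4" "k + 4" "k + 4"]
    by (simp add: p_def q_def x_def algebra_simps eval_nat_numeral)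
  have r5: "?S 1 0 0 = ?S 1 1 0 + x ^ 2 * q ^ 3 * p ^ 2 * (?S 3 2 2 + q * ?S 3 3 2)"
    using kr_series_diff_2[of "k + 1" k k]
    by (simp add: p_def q_def x_def algebra_simps eval_nat_numeral power_add power_mult)
  have r6: "?S 4 4 3 = ?S 4 3 3 - x ^ 2 * q ^ 9 * p ^ 2 * (?S 6 5 5 + q * ?S 6 6 5)"
    using kr_series_diff_2[of "k + 4" "k + 3" "k + 3"]
    by (simp add: p_def q_def x_def algebra_simps eval_nat_numeral power_add power_mult)
  have r7: "?S 1 1 0 = ?S 1 1 1 + x ^ 3 * q ^ 5 * p ^ 3 * ?S 4 4 3"
    using kr_series_diff_3[of "k + 1" "k + 1" k]
    by (simp add: p_def q_def x_def algebra_simps eval_nat_numeral power_add power_mult)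
  have r8: "?S 3 3 2 = ?S 3 3 3 + x ^ 3 * q ^ 11 * p ^ 3 * ?S 6 6 5"
    using kr_series_diff_3[of "k + 3" "k + 3" "k + 2"]
    by (simp add: p_def q_def x_def algebra_simps eval_nat_numeral power_add power_mult)
  have "?S 0 0 0 =
     (1 + x * (q * p)) * ?S 1 1 1
     + x\<^sup>2 * (q ^ 4 * p ^ 2) * (1 + x * (q * p)) * ?S 3 3 3
     - x ^ 4 * (q ^ 9 * p ^ 4) * ?S 4 4 4"
    unfolding r1 r2 r5 r7 r8 r6 r3 r4
    by (simp add: algebra_simps eval_nat_numeral)
  moreover have "q ^ (k + 1) = q * p" "q ^ (2 * k + 4) = q ^ 4 * p ^ 2" "q ^ (4 * k + 9) = q ^ 9 * p ^ 4"
    by (simp_all add: p_def power_add power_mult[symmetric] mult.commute)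
  ultimately show "kr_series k k k =
     (1 + fps_X * fps_const fps_X ^ (k + 1)) * kr_series (k + 1) (k + 1) (k + 1)
     + fps_X\<^sup>2 * fps_const fps_X ^ (2 * k + 4) * (1 + fps_X * fps_const fps_X ^ (k + 1))
         * kr_series (k + 3) (k + 3) (k + 3)
     - fps_X ^ 4 * fps_const fps_X ^ (4 * k + 9) * kr_series (k + 4) (k + 4) (k + 4)"
    by (simp only: x_def q_def add_0_right)
qed

lemma kr_series_nth_0: "fps_nth (kr_series a u v) 0 = 1"
proof -
  have "{t. weight t = 0} = {(0, 0, 0)}"
    by auto
  thus ?thesis
    by (simp add: kr_series_def series_by_weight_def)
qed

text \<open>The exponent of $q$ contains $k$ times the weight of the triple, and the weight is the
exponent of $x$.\<close>

lemma kr_series_nth_low: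
  assumes "m > 0" "n < k"
  shows "fps_nth (fps_nth (kr_series k k k) m) n = 0"
proof -
  have "fps_nth (kr_coeff k k k t) n = 0" if "weight t = m" for t
  proof (cases t)
    case (fields n1 n2 n3)
    have "n < k * m"
      using assms by (cases m) auto
    also have "\<dots> \<le> kr_exponent k k k (n1, n2, n3)"
      using that unfolding fields by (auto simp: algebra_simps)
    finally show ?thesis
      unfolding fields kr_coeff.simps by (simp only: fps_X_power_mult_nth if_True)
  qed
  thus ?thesis
    by (simp add: kr_series_def series_by_weight_def fps_sum_nth)
qed

lemma kr6_summand_eq:
  "kr6_summand n1 n2 n3 = fps_const (kr_coeff 1 1 1 (n1, n2, n3)) * fps_X ^ weight (n1, n2, n3)"
proof -
  let ?A = "qpochhammer fps_X fps_X n1 :: rat fps"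
  let ?B = "qpochhammer (fps_X ^ 2) (fps_X ^ 2) n2 :: rat fps"
  let ?C = "qpochhammer (fps_X ^ 3) (fps_X ^ 3) n3 :: rat fps"
  have nth_0: "fps_nth (qpochhammer (fps_X ^ Suc j) (fps_X ^ Suc j) n :: rat fps) 0 = 1" for j n
    by (induction n) (simp_all add: qpochhammer_Suc)
  have "fps_nth (?A * ?B * ?C) 0 \<noteq> 0"
    using nth_0[of 0 n1] nth_0[of 1 n2] nth_0[of 2 n3] by (simp add: numeral_2_eq_2 numeral_3_eq_3)
  hence quotient: "f / (?A * ?B * ?C) = f * (inv_qpoch 1 n1 * inv_qpoch 2 n2 * inv_qpoch 3 n3)" for f
    by (subst fps_divide_unit) (simp_all add: inv_qpoch_def fps_inverse_mult)
  have "9 * n3\<^sup>2 + 7 * n3 = (9 * n3\<^sup>2 + n3) + 2 * (3 * n3)"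
    by simp
  hence half: "(9 * n3\<^sup>2 + 7 * n3) div 2 = (9 * n3\<^sup>2 + n3) div 2 + 3 * n3"
    by simp
  have "(9 * n3 ^ 2 + 7 * n3) div 2 + 2 * n2 ^ 2 + 3 * n2 + n1 ^ 2 + n1
              + 6 * n3 * n2 + 3 * n3 * n1 + 2 * n2 * n1 = kr_exponent 1 1 1 (n1, n2, n3)"
    unfolding half by simp
  thus ?thesis
    unfolding kr6_summand_def Let_def quotient by (simp only: kr_coeff.simps weight.simps mult.assoc)
qed

section \<open>The identity\<close>

lemma kr6_partitions_eq:
  "kr6_partitions n m = {ps \<in> admissible_ge_once 2. sum_list ps = n \<and> length ps = m}"
proof -
  have "count_list ps 2 \<le> 1 \<longleftrightarrow> \<not> (\<exists>r. ps = 2 # 2 # r)" if ps: "ps \<in> admissible_ge 2" for ps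
  proof -
    consider "ps = []" | a where "ps = [a]" | a b r where "ps = a # b # r"
      by (metis list.exhaust)
    thus ?thesis
    proof cases
      case 3
      have adm: "admissible (a # b # r)" and "2 \<le> a"
        using ps unfolding 3 by simp_all
      have "count_list (b # r) 2 = 0" if "\<not> (a = 2 \<and> b = 2)"
        using that admissible_sorted[OF adm] \<open>2 \<le> a\<close> by (auto simp: count_list_0_iff)
      thus ?thesis
        unfolding 3 by (cases "a = 2 \<and> b = 2") auto
    qed auto
  qed
  moreover have "p > 0" if "ps \<in> admissible_ge 2" "p \<in> set ps" for p ps
    using that by (force simp: admissible_ge_def)
  ultimately show ?thesis
    unfolding kr6_partitions_def partition_into_def admissible_ge_once_def admissible_ge_def
      admissible_def
    by blast
qed

theorem theorem15:
  shows "((\<lambda>(n1, n2, n3). kr6_summand n1 n2 n3) has_sum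
           Abs_fps (\<lambda>m. Abs_fps (\<lambda>n. of_nat (kr6 n m)))) UNIV"
proof -
  have "partition_gf (admissible_ge_once (1 + 1)) = kr_series 1 1 1"
    using partition_gf_recurrence kr_series_recurrence
    by (rule kr_recurrence_unique)
       (simp_all add: partition_gf_nth_0 kr_series_nth_0 partition_gf_nth_low kr_series_nth_low)
  moreover have "Abs_fps (\<lambda>m. Abs_fps (\<lambda>n. of_nat (kr6 n m))) = partition_gf (admissible_ge_once 2)"
    by (simp add: partition_gf_def kr6_def kr6_partitions_eq)
  ultimately have "Abs_fps (\<lambda>m. Abs_fps (\<lambda>n. of_nat (kr6 n m))) = kr_series 1 1 1"
    by (simp add: numeral_2_eq_2)
  moreover have "(\<lambda>(n1, n2, n3). kr6_summand n1 n2 n3) =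
      (\<lambda>t. fps_const (kr_coeff 1 1 1 t) * fps_X ^ weight t)"
    by (auto simp: fun_eq_iff kr6_summand_eq simp del: weight.simps kr_coeff.simps)
  ultimately show ?thesis
    using series_by_weight_has_sum[of "kr_coeff 1 1 1"] by (simp only: kr_series_def)
qed

end
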